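(* Let $n\ge 2$, let $\mathfrak g$ be a $2n$-dimensional real nilpotent Lie algebra, and let $J$ be a 1-abelian complex structure on $\mathfrak g$ admitting a basis $\{\omega^i\}_{i=1}^n$ of $\mathfrak g^{1,0}$ with $d\omega^1=\dots=d\omega^{n-1}=0$ and $d\omega^n=\sum_{j,k=1}^{n-1}M_{jk}\,\omega^{j}\wedge\overline{\omega^{k}}$, where $M\in M_{n-1}(\mathbb C)$ is a Hermitian matrix. Put $r=\dim\ker M$. Then there exists a basis $\{\sigma^i\}_{i=1}^n$ of $\mathfrak g^{1,0}$ such that the complex structure equations are one of the following: $$J_{n,k,r}:\quad d\sigma^1=\dots=d\sigma^{n-1}=0,\qquad d\sigma^n=\sum_{j=1}^{k}\sigma^{j\bar j}-\sum_{j=k+1}^{n-1-r}\sigma^{j\bar j},$$ with $k\in\{\lfloor\frac{n-1-r}{2}\rfloor,\dots,n-1-r\}$ if $n-r$ is odd, or $k\in\{\lfloor\frac{n-1-r}{2}\rfloor+1,\dots,n-1-r\}$ if $n-r$ is even (empty sums are $0$).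
   Context: For a complex structure $J$ on a real Lie algebra $\mathfrak g$ (an endomorphism with $J^2=-\mathrm{Id}$ and vanishing Nijenhuis tensor), $\mathfrak g^{1,0}\subset\mathfrak g^*_{\mathbb C}$ is the space of $(1,0)$-forms and $d$ is the Chevalley–Eilenberg differential extended to $\bigwedge^*\mathfrak g^*_{\mathbb C}$. We write $\sigma^{j\bar k}=\sigma^j\wedge\overline{\sigma^k}$. $J$ is abelian if $[Jx,Jy]=[x,y]$ for all $x,y\in\mathfrak g$; equivalently $d(\mathfrak g^{1,0})\subset\bigwedge^{1,1}\mathfrak g^*$. An abelian complex structure on a $2n$-dimensional nilpotent Lie algebra is called 1-abelian if $h^{1,0}=n-1$, where $h^{1,0}=\dim H^{1,0}_{\bar\partial}(\mathfrak g)$ is the dimension of $\ker(\bar\partial:\mathfrak g^{1,0}\to\bigwedge^{1,1}\mathfrak g^* )$. In particular the matrix $M$ of a 1-abelian structure is nonzero. *)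

theory Defs
  imports
    Complex_Main
    "HOL-Library.Function_Algebras"
    "Jordan_Normal_Form.Matrix_Kernel"
    "Jordan_Normal_Form.Schur_Decomposition"
begin

section \<open>Real nilpotent Lie algebras\<close>

locale real_lie_algebra =
  fixes br :: "'a::real_vector \<Rightarrow> 'a \<Rightarrow> 'a"
  assumes linear_left: "linear (\<lambda>x. br x y)"
    and linear_right: "linear (\<lambda>y. br x y)"
    and alternating: "br x x = 0"
    and jacobi: "br x (br y z) + br y (br z x) + br z (br x y) = 0"

fun lower_central :: "('a::real_vector \<Rightarrow> 'a \<Rightarrow> 'a) \<Rightarrow> nat \<Rightarrow> 'a set" where
  "lower_central br 0 = UNIV"
| "lower_central br (Suc m) = real_vector.span {br x y | x y. y \<in> lower_central br m}"

definition nilpotent_bracket :: "('a::real_vector \<Rightarrow> 'a \<Rightarrow> 'a) \<Rightarrow> bool" where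
  "nilpotent_bracket br \<longleftrightarrow> (\<exists>m. lower_central br m = {0})"

section \<open>Complex structures\<close>

definition nijenhuis :: "('a::real_vector \<Rightarrow> 'a \<Rightarrow> 'a) \<Rightarrow> ('a \<Rightarrow> 'a) \<Rightarrow> 'a \<Rightarrow> 'a \<Rightarrow> 'a" where
  "nijenhuis br J x y = br x y + J (br (J x) y) + J (br x (J y)) - br (J x) (J y)"

definition complex_structure :: "('a::real_vector \<Rightarrow> 'a \<Rightarrow> 'a) \<Rightarrow> ('a \<Rightarrow> 'a) \<Rightarrow> bool" where
  "complex_structure br J \<longleftrightarrow>
     linear J \<and> (\<forall>x. J (J x) = - x) \<and> (\<forall>x y. nijenhuis br J x y = 0)"

definition abelian_complex_structure ::
    "('a::real_vector \<Rightarrow> 'a \<Rightarrow> 'a) \<Rightarrow> ('a \<Rightarrow> 'a) \<Rightarrow> bool" where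
  "abelian_complex_structure br J \<longleftrightarrow>
     complex_structure br J \<and> (\<forall>x y. br (J x) (J y) = br x y)"

section \<open>Complex-valued forms\<close>

text \<open>
  The complexified dual of a real vector space is identified with the space of its real-linear
  maps to the complex numbers, and a complex 2-form with a complex-valued alternating real-bilinear
  map. Addition, zero and finite sums of forms are the pointwise ones of
  \<^theory>\<open>HOL-Library.Function_Algebras\<close>.
\<close>

definition scale1 :: "complex \<Rightarrow> ('a \<Rightarrow> complex) \<Rightarrow> 'a \<Rightarrow> complex" where
  "scale1 c \<alpha> = (\<lambda>x. c * \<alpha> x)"

definition scale2 :: "complex \<Rightarrow> ('a \<Rightarrow> 'a \<Rightarrow> complex) \<Rightarrow> 'a \<Rightarrow> 'a \<Rightarrow> complex" where
  "scale2 c \<beta> = (\<lambda>x y. c * \<beta> x y)"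

global_interpretation form1: vector_space "scale1 :: complex \<Rightarrow> ('a \<Rightarrow> complex) \<Rightarrow> 'a \<Rightarrow> complex"
  by unfold_locales (auto simp: scale1_def fun_eq_iff algebra_simps)

global_interpretation form2:
  vector_space "scale2 :: complex \<Rightarrow> ('a \<Rightarrow> 'a \<Rightarrow> complex) \<Rightarrow> 'a \<Rightarrow> 'a \<Rightarrow> complex"
  by unfold_locales (auto simp: scale2_def fun_eq_iff algebra_simps)

definition cnj_form :: "('a \<Rightarrow> complex) \<Rightarrow> 'a \<Rightarrow> complex" where
  "cnj_form \<alpha> = (\<lambda>x. cnj (\<alpha> x))"

definition wedge :: "('a \<Rightarrow> complex) \<Rightarrow> ('a \<Rightarrow> complex) \<Rightarrow> 'a \<Rightarrow> 'a \<Rightarrow> complex" where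
  "wedge \<alpha> \<beta> = (\<lambda>x y. \<alpha> x * \<beta> y - \<alpha> y * \<beta> x)"

text \<open>The Chevalley--Eilenberg differential on 1-forms.\<close>

definition ce_d :: "('a \<Rightarrow> 'a \<Rightarrow> 'a) \<Rightarrow> ('a \<Rightarrow> complex) \<Rightarrow> 'a \<Rightarrow> 'a \<Rightarrow> complex" where
  "ce_d br \<alpha> = (\<lambda>x y. - \<alpha> (br x y))"

definition forms10 :: "('a::real_vector \<Rightarrow> 'a) \<Rightarrow> ('a \<Rightarrow> complex) set" where
  "forms10 J = {\<alpha>. linear \<alpha> \<and> (\<forall>x. \<alpha> (J x) = \<i> * \<alpha> x)}"

definition forms01 :: "('a::real_vector \<Rightarrow> 'a) \<Rightarrow> ('a \<Rightarrow> complex) set" where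
  "forms01 J = cnj_form ` forms10 J"

definition forms20 :: "('a::real_vector \<Rightarrow> 'a) \<Rightarrow> ('a \<Rightarrow> 'a \<Rightarrow> complex) set" where
  "forms20 J = form2.span {wedge \<alpha> \<beta> | \<alpha> \<beta>. \<alpha> \<in> forms10 J \<and> \<beta> \<in> forms10 J}"

definition forms11 :: "('a::real_vector \<Rightarrow> 'a) \<Rightarrow> ('a \<Rightarrow> 'a \<Rightarrow> complex) set" where
  "forms11 J = form2.span {wedge \<alpha> \<beta> | \<alpha> \<beta>. \<alpha> \<in> forms10 J \<and> \<beta> \<in> forms01 J}"

definition forms02 :: "('a::real_vector \<Rightarrow> 'a) \<Rightarrow> ('a \<Rightarrow> 'a \<Rightarrow> complex) set" where
  "forms02 J = form2.span {wedge \<alpha> \<beta> | \<alpha> \<beta>. \<alpha> \<in> forms01 J \<and> \<beta> \<in> forms01 J}"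

text \<open>
  The (1,1)-component of the differential of a 1-form. It exists and is unique when the Lie
  algebra is finite-dimensional and \<open>J\<close> is an almost complex structure.
\<close>

definition delbar ::
    "('a::real_vector \<Rightarrow> 'a \<Rightarrow> 'a) \<Rightarrow> ('a \<Rightarrow> 'a) \<Rightarrow> ('a \<Rightarrow> complex) \<Rightarrow> 'a \<Rightarrow> 'a \<Rightarrow> complex" where
  "delbar br J \<alpha> = (THE \<beta>. \<beta> \<in> forms11 J \<and>
     (\<exists>\<gamma>\<in>forms20 J. \<exists>\<delta>\<in>forms02 J. ce_d br \<alpha> = \<gamma> + \<beta> + \<delta>))"

definition h10 :: "('a::real_vector \<Rightarrow> 'a \<Rightarrow> 'a) \<Rightarrow> ('a \<Rightarrow> 'a) \<Rightarrow> nat" where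
  "h10 br J = form1.dim {\<alpha> \<in> forms10 J. delbar br J \<alpha> = 0}"

text \<open>
  1-abelian structures, on a Lie algebra of real dimension \<open>2 * n\<close>. Since the dimension of an
  infinite-dimensional space is 0 by convention, finite-dimensionality is enforced for positive
  \<open>n\<close> only.
\<close>

definition one_abelian ::
    "nat \<Rightarrow> ('a::real_vector \<Rightarrow> 'a \<Rightarrow> 'a) \<Rightarrow> ('a \<Rightarrow> 'a) \<Rightarrow> bool" where
  "one_abelian n br J \<longleftrightarrow>
     real_lie_algebra br \<and> nilpotent_bracket br \<and> real_vector.dim (UNIV :: 'a set) = 2 * n \<and>
     abelian_complex_structure br J \<and> h10 br J = n - 1"

definition basis10 :: "nat \<Rightarrow> ('a::real_vector \<Rightarrow> 'a) \<Rightarrow> (nat \<Rightarrow> 'a \<Rightarrow> complex) \<Rightarrow> bool" where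
  "basis10 n J \<omega> \<longleftrightarrow>
     inj_on \<omega> {1..n} \<and> form1.independent (\<omega> ` {1..n}) \<and> form1.span (\<omega> ` {1..n}) = forms10 J"

definition hermitian_mat :: "complex mat \<Rightarrow> bool" where
  "hermitian_mat M \<longleftrightarrow> mat_adjoint M = M"

end

theory Submission
  imports Defs "Jordan_Normal_Form.Spectral_Radius"
begin

text \<open>
  Only the Hermitian form \<open>\<Sum> M\<^sub>j\<^sub>k z\<^sub>j cnj z\<^sub>k\<close> matters: replacing \<open>\<omega>\<^sup>1, \<dots>, \<omega>\<^sup>n\<^sup>-\<^sup>1\<close> by invertible linear
  combinations of themselves keeps them closed and changes \<open>M\<close> by a congruence. The theorem is
  therefore the normal form part of Sylvester's law for Hermitian matrices, together with a sign
  normalisation.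

  A Hermitian matrix is diagonalised by a congruence (\<open>hermitian_mat_diagonalizable_congruence\<close>):
  in an orthogonal frame starting with an eigenvector, the first column and, by symmetry, the first
  row vanish off the diagonal, and induction applies to the remaining Hermitian block. An invertible
  congruence preserves the dimension of the kernel, so exactly \<open>r\<close> of the real diagonal entries are
  zero (\<open>hermitian_mat_signed_decomposition\<close>). Read on forms, \<open>M = P D P\<^sup>*\<close> says that
  \<open>d\<omega>\<^sup>n = \<Sum> d\<^sub>l \<tau>\<^sup>l \<and> cnj \<tau>\<^sup>l\<close> for the combinations \<open>\<tau>\<^sup>l\<close> with coefficients in the columns of \<open>P\<close>
  (\<open>wedge_cnj_congruence\<close>).

  It remains to rescale \<open>\<tau>\<^sup>l\<close> by the square root of \<open>\<bar>d\<^sub>l\<bar>\<close>, and to enumerate the entries so that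
  the positive ones come first and the zeros last. Replacing \<open>\<omega>\<^sup>n\<close> by its negative exchanges the
  numbers of positive and negative entries, so the former may be taken to be at least the latter.
  As the two numbers add up to \<open>n - 1 - r\<close>, this is the stated range of \<open>k\<close>. The new forms span the same space
  as the old ones, and a spanning family indexed by \<open>{1..n}\<close> of an \<open>n\<close>-dimensional space is a basis
  (\<open>same_span_imp_basis_family\<close>).
\<close>

section \<open>Adjoint and Hermitian matrices\<close>

lemma mat_adjoint_index:
  assumes "i < dim_col A" "j < dim_row A"
  shows "mat_adjoint A $$ (i, j) = conjugate (A $$ (j, i))"
  using assms by (simp add: mat_adjoint_def mat_of_rows_index)

lemma dim_mat_adjoint [simp]:
  "dim_row (mat_adjoint A) = dim_col A" "dim_col (mat_adjoint A) = dim_row A"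
  by (simp_all add: mat_adjoint_def)

lemma mat_adjoint_carrier [simp, intro]:
  "A \<in> carrier_mat nr nc \<Longrightarrow> mat_adjoint A \<in> carrier_mat nc nr"
  by (auto simp: mat_adjoint_def)

lemma mat_adjoint_mult:
  fixes A B :: "complex mat"
  assumes A: "A \<in> carrier_mat nr n" and B: "B \<in> carrier_mat n nc"
  shows "mat_adjoint (A * B) = mat_adjoint B * mat_adjoint A"
proof (rule eq_matI)
  have AB: "A * B \<in> carrier_mat nr nc" using A B by auto
  have BA: "mat_adjoint B * mat_adjoint A \<in> carrier_mat nc nr" using A B by auto
  fix i j assume "i < dim_row (mat_adjoint B * mat_adjoint A)"
    "j < dim_col (mat_adjoint B * mat_adjoint A)"
  hence i: "i < nc" and j: "j < nr" using BA by auto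
  have "mat_adjoint (A * B) $$ (i, j) = cnj (\<Sum>k<n. A $$ (j, k) * B $$ (k, i))"
    using AB i j A B by (subst mat_adjoint_index) (auto simp: scalar_prod_def lessThan_atLeast0)
  also have "\<dots> = (\<Sum>k<n. cnj (B $$ (k, i)) * cnj (A $$ (j, k)))"
    by (simp add: mult.commute)
  also have "\<dots> = (\<Sum>k<n. mat_adjoint B $$ (i, k) * mat_adjoint A $$ (k, j))"
    using A B i j by (intro sum.cong refl) (simp add: mat_adjoint_index)
  also have "\<dots> = (mat_adjoint B * mat_adjoint A) $$ (i, j)"
    using i j A B by (auto simp: scalar_prod_def lessThan_atLeast0)
  finally show "mat_adjoint (A * B) $$ (i, j) = (mat_adjoint B * mat_adjoint A) $$ (i, j)" .
qed (use A B in \<open>auto simp: mat_adjoint_def\<close>)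

lemma mat_adjoint_adjoint [simp]:
  fixes A :: "complex mat"
  shows "mat_adjoint (mat_adjoint A) = A"
  by (rule eq_matI) (auto simp: mat_adjoint_index)

text \<open>
  This regrouping composes two congruences, and lets a congruence cancel against its inverse. It is
  proved by explicit instances because the carrier conditions of associativity have intermediate
  dimensions that rewriting cannot guess.
\<close>

lemma mult_mat_regroup:
  fixes A B C D E :: "'b::semiring_0 mat"
  assumes A: "A \<in> carrier_mat n n" and B: "B \<in> carrier_mat n n" and C: "C \<in> carrier_mat n n"
    and D: "D \<in> carrier_mat n n" and E: "E \<in> carrier_mat n n"
  shows "A * (B * C * D) * E = (A * B) * C * (D * E)"
proof -
  note BC = mult_carrier_mat[OF B C] and AB = mult_carrier_mat[OF A B]
  show ?thesis
    unfolding assoc_mult_mat[OF A BC D, symmetric] assoc_mult_mat[OF A B C, symmetric]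
    by (rule assoc_mult_mat[OF mult_carrier_mat[OF AB C] D E])
qed

lemma hermitian_mat_index:
  assumes "hermitian_mat A" "A \<in> carrier_mat n n" "i < n" "j < n"
  shows "A $$ (i, j) = cnj (A $$ (j, i))"
  using assms mat_adjoint_index[of i A j] by (auto simp: hermitian_mat_def)

lemma hermitian_mat_congruent:
  assumes "hermitian_mat A" "A \<in> carrier_mat n n" "W \<in> carrier_mat n m"
  shows "hermitian_mat (mat_adjoint W * A * W)"
proof -
  note A = assms(2) and W = assms(3)
  note W' = mat_adjoint_carrier[OF W]
  have "mat_adjoint (mat_adjoint W * A * W) = mat_adjoint W * (mat_adjoint A * W)"
    unfolding mat_adjoint_mult[OF mult_carrier_mat[OF W' A] W] mat_adjoint_mult[OF W' A] by simp
  also have "\<dots> = mat_adjoint W * A * W"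
    using assms(1) assoc_mult_mat[OF W' A W] by (simp add: hermitian_mat_def)
  finally show ?thesis by (simp add: hermitian_mat_def)
qed

lemma inverse_mat_obtain:
  fixes A :: "complex mat"
  assumes A: "A \<in> carrier_mat n n" and d: "det A \<noteq> 0"
  obtains B where "B \<in> carrier_mat n n" "A * B = 1\<^sub>m n" "B * A = 1\<^sub>m n"
  using det_non_zero_imp_unit[OF A d, of "()"] by (auto simp: Units_def ring_mat_def)

lemma det_mat_adjoint_nonzero:
  fixes A :: "complex mat"
  assumes A: "A \<in> carrier_mat n n" and d: "det A \<noteq> 0"
  shows "det (mat_adjoint A) \<noteq> 0"
proof -
  obtain B where B: "B \<in> carrier_mat n n" "A * B = 1\<^sub>m n"
    using inverse_mat_obtain[OF A d] by metis
  have "mat_adjoint (1\<^sub>m n :: complex mat) = 1\<^sub>m n"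
    by (rule eq_matI) (auto simp: mat_adjoint_index)
  hence "mat_adjoint B * mat_adjoint A = 1\<^sub>m n"
    using mat_adjoint_mult[OF A B(1)] B(2) by simp
  hence "det (mat_adjoint B) * det (mat_adjoint A) = 1"
    using det_mult[of "mat_adjoint B" n "mat_adjoint A"] A B by simp
  thus ?thesis by auto
qed

section \<open>Diagonalisation by congruence\<close>

text \<open>
  Complete an eigenvector \<open>v\<close> to an orthogonal frame \<open>W\<close> with \<open>v\<close> as first column. The first column
  of \<open>W\<^sup>* A W\<close> consists of the inner products of \<open>A v\<close>, a multiple of \<open>v\<close>, with the frame, so only its
  first entry survives. The frame is not normalised, hence \<open>W\<close> need not be unitary; a congruence
  requires no more than its invertibility.
\<close>

lemma hermitian_eigenvector_frame:
  fixes A :: "complex mat"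
  assumes A: "A \<in> carrier_mat n n" and n: "n > 0"
  obtains W where "W \<in> carrier_mat n n" "det W \<noteq> 0"
    "\<And>i. 0 < i \<Longrightarrow> i < n \<Longrightarrow> (mat_adjoint W * A * W) $$ (i, 0) = 0"
proof -
  obtain e where "eigenvalue A e"
    using spectrum_non_empty[OF A n] by (auto simp: spectrum_def)
  then obtain v where "eigenvector A v e" unfolding eigenvalue_def by auto
  with A have v: "v \<in> carrier_vec n" and v0: "v \<noteq> 0\<^sub>v n" and Av: "A *\<^sub>v v = e \<cdot>\<^sub>v v"
    by (auto simp: eigenvector_def)
  interpret cof_vec_space n "TYPE(complex)" .
  define b where "b = basis_completion v"
  define ws where "ws = gram_schmidt n b"
  define W where "W = mat_of_cols n ws"
  from basis_completion[OF v v0, folded b_def]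
  have b: "set b \<subseteq> carrier_vec n" "distinct b" "\<not> lin_dep (set b)" "hd b = v" "length b = n"
    by auto
  from b(4,5) n obtain vs where bv: "b = v # vs" by (cases b) auto
  from gram_schmidt_result[OF b(1-3) refl, folded ws_def] b(5)
  have ws: "set ws \<subseteq> carrier_vec n" "corthogonal ws" "length ws = n" by auto
  have ws0: "ws ! 0 = v"
    using gram_schmidt_hd[OF v, of vs, folded bv] ws(3) n by (cases ws) (auto simp: ws_def)
  have W: "W \<in> carrier_mat n n" using ws(3) by (auto simp: W_def)
  have colW: "col W i = ws ! i" if "i < n" for i
    using that ws by (simp add: W_def subset_iff)
  have orth: "corthogonal_mat W" using orthogonal_mat_of_cols[OF ws] by (simp add: W_def)
  have "corthogonal_inv W * W = 1\<^sub>m n"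
    using corthogonal_inv_result[OF orth] W
    by (simp add: inverts_mat_def corthogonal_inv_def)
  moreover have "corthogonal_inv W \<in> carrier_mat n n"
    using W by (auto simp: corthogonal_inv_def)
  ultimately have "det (corthogonal_inv W) * det W = 1"
    using det_mult[OF _ W, of "corthogonal_inv W"] by simp
  hence "det W \<noteq> 0" by auto
  moreover have "(mat_adjoint W * A * W) $$ (i, 0) = 0" if i: "0 < i" "i < n" for i
  proof -
    have W': "mat_adjoint W \<in> carrier_mat n n" using W by auto
    have "(mat_adjoint W * A * W) $$ (i, 0) = (mat_adjoint W * (A * W)) $$ (i, 0)"
      using W W' A by (simp add: assoc_mult_mat[of _ n n _ n _ n])
    also have "\<dots> = row (mat_adjoint W) i \<bullet> col (A * W) 0"
      by (rule index_mult_mat(1)) (use W W' A i in auto)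
    also have "col (A * W) 0 = A *\<^sub>v col W 0" by (rule col_mult2[OF A W n])
    also have "\<dots> = e \<cdot>\<^sub>v col W 0"
      using Av colW[OF n] ws0 by simp
    also have "row (mat_adjoint W) i \<bullet> (e \<cdot>\<^sub>v col W 0) = e * (conjugate (col W i) \<bullet> col W 0)"
      using W i v by (simp add: mat_adjoint_def)
    also have "conjugate (col W i) \<bullet> col W 0 = col W 0 \<bullet>c col W i"
      by (rule comm_scalar_prod[of _ n]) (use W in auto)
    also have "\<dots> = 0" using corthogonal_matD[OF orth, of 0 i] W i n by auto
    finally show ?thesis by simp
  qed
  ultimately show thesis using that W by blast
qed

lemma mat_adjoint_four_block_diag:
  fixes A D :: "complex mat"
  assumes "A \<in> carrier_mat k k" "D \<in> carrier_mat m m"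
  shows "mat_adjoint (four_block_mat A (0\<^sub>m k m) (0\<^sub>m m k) D) =
    four_block_mat (mat_adjoint A) (0\<^sub>m k m) (0\<^sub>m m k) (mat_adjoint D)"
  by (rule eq_matI) (use assms in \<open>auto simp: mat_adjoint_index four_block_mat_def Let_def\<close>)

text \<open>
  Splitting off the first vector of an eigenvector frame leaves a Hermitian block of size one less.
\<close>

lemma hermitian_mat_diagonalizable_congruence:
  assumes "A \<in> carrier_mat n n" "hermitian_mat A"
  shows "\<exists>W \<in> carrier_mat n n. det W \<noteq> 0 \<and> diagonal_mat (mat_adjoint W * A * W)"
  using assms
proof (induction n arbitrary: A)
  case 0
  thus ?case by (intro bexI[of _ "1\<^sub>m 0"]) (auto simp: diagonal_mat_def)
next
  case (Suc n)
  note A = Suc.prems(1)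
  obtain V where V: "V \<in> carrier_mat (Suc n) (Suc n)" "det V \<noteq> 0"
    and V0: "\<And>i. 0 < i \<Longrightarrow> i < Suc n \<Longrightarrow> (mat_adjoint V * A * V) $$ (i, 0) = 0"
    using hermitian_eigenvector_frame[OF A] by auto
  define H where "H = mat_adjoint V * A * V"
  have V': "mat_adjoint V \<in> carrier_mat (Suc n) (Suc n)" using V by auto
  have H: "H \<in> carrier_mat (Suc n) (Suc n)" using V V' A unfolding H_def by (metis mult_carrier_mat)
  have hH: "hermitian_mat H" unfolding H_def by (rule hermitian_mat_congruent[OF Suc.prems(2) A V(1)])
  define c where "c = mat 1 1 (\<lambda>_. H $$ (0, 0))"
  define B where "B = mat n n (\<lambda>(i, j). H $$ (Suc i, Suc j))"
  have c: "c \<in> carrier_mat 1 1" and B: "B \<in> carrier_mat n n" by (auto simp: c_def B_def)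
  have H0: "H $$ (i, 0) = 0" "H $$ (0, i) = 0" if "0 < i" "i < Suc n" for i
    using V0[OF that] hermitian_mat_index[OF hH H, of 0 i] that by (auto simp: H_def)
  have Hblock: "H = four_block_mat c (0\<^sub>m 1 n) (0\<^sub>m n 1) B"
    by (rule eq_matI) (use H H0 in \<open>auto simp: c_def B_def\<close>)
  have "cnj (H $$ (Suc j, Suc i)) = H $$ (Suc i, Suc j)" if "i < n" "j < n" for i j
    using hermitian_mat_index[OF hH H, of "Suc i" "Suc j"] that by simp
  hence "hermitian_mat B"
    unfolding hermitian_mat_def
    by (intro eq_matI) (auto simp: mat_adjoint_index B_def)
  from Suc.IH[OF B this] obtain U where U: "U \<in> carrier_mat n n" "det U \<noteq> 0"
    and dU: "diagonal_mat (mat_adjoint U * B * U)" by blast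
  define U1 where "U1 = four_block_mat (1\<^sub>m 1) (0\<^sub>m 1 n) (0\<^sub>m n 1) U"
  have U': "mat_adjoint U \<in> carrier_mat n n" using U by auto
  have one': "mat_adjoint (1\<^sub>m 1 :: complex mat) = 1\<^sub>m 1"
    by (rule eq_matI) (auto simp: mat_adjoint_index)
  have U1: "U1 \<in> carrier_mat (Suc n) (Suc n)"
    using U by (auto simp: U1_def)
  have detU1: "det U1 \<noteq> 0"
    using U det_four_block_mat_lower_left_zero[of "1\<^sub>m 1" 1 "0\<^sub>m 1 n" n "0\<^sub>m n 1" U]
    by (auto simp: U1_def)
  have U1': "mat_adjoint U1 = four_block_mat (1\<^sub>m 1) (0\<^sub>m 1 n) (0\<^sub>m n 1) (mat_adjoint U)"
    using mat_adjoint_four_block_diag[of "1\<^sub>m 1" 1 U n] U one' by (simp add: U1_def)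
  have prod1: "mat_adjoint U1 * H = four_block_mat c (0\<^sub>m 1 n) (0\<^sub>m n 1) (mat_adjoint U * B)"
    unfolding U1' Hblock
    by (subst mult_four_block_mat[of _ 1 1 _ n _ n _ _ 1 _ n])
      (use c B U' right_mult_zero_mat[OF U', of 1] in auto)
  have prod2: "mat_adjoint U1 * H * U1 = four_block_mat c (0\<^sub>m 1 n) (0\<^sub>m n 1) (mat_adjoint U * B * U)"
    unfolding prod1 unfolding U1_def
    by (subst mult_four_block_mat[of _ 1 1 _ n _ n _ _ 1 _ n]) (use c B U U' in auto)
  have "diagonal_mat (mat_adjoint U1 * H * U1)"
    unfolding prod2 diagonal_mat_def
  proof (intro allI impI)
    fix i j
    assume "i < dim_row (four_block_mat c (0\<^sub>m 1 n) (0\<^sub>m n 1) (mat_adjoint U * B * U))"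
      "j < dim_col (four_block_mat c (0\<^sub>m 1 n) (0\<^sub>m n 1) (mat_adjoint U * B * U))" "i \<noteq> j"
    hence "i < Suc n" "j < Suc n" using c U U' B by auto
    thus "four_block_mat c (0\<^sub>m 1 n) (0\<^sub>m n 1) (mat_adjoint U * B * U) $$ (i, j) = 0"
      using dU \<open>i \<noteq> j\<close> c mult_carrier_mat[OF mult_carrier_mat[OF U' B] U(1)]
      by (cases i; cases j) (auto simp: diagonal_mat_def simp del: index_mult_mat(1))
  qed
  moreover have "mat_adjoint (V * U1) * A * (V * U1) = mat_adjoint U1 * H * U1"
    unfolding mat_adjoint_mult[OF V(1) U1] H_def
    by (rule mult_mat_regroup[OF mat_adjoint_carrier[OF U1] V' A V(1) U1, symmetric])
  moreover have "det (V * U1) \<noteq> 0" using det_mult[OF V(1) U1] V detU1 by simp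
  ultimately show ?case using V U1 by (intro bexI[of _ "V * U1"]) auto
qed

section \<open>Counting the zero diagonal entries\<close>

text \<open>
  The unit vectors at the positions of the zero diagonal entries form a basis of the kernel.
\<close>

lemma kernel_dim_diagonal_mat:
  fixes D :: "complex mat"
  assumes D: "D \<in> carrier_mat n n" and diag: "diagonal_mat D"
  shows "kernel_dim D = card {i. i < n \<and> D $$ (i, i) = 0}"
proof -
  define Z where "Z = {i. i < n \<and> D $$ (i, i) = 0}"
  interpret kernel n n D by unfold_locales (rule D)
  define S :: "complex vec set" where "S = unit_vec n ` Z"
  have Dv: "(D *\<^sub>v v) $ i = D $$ (i, i) * v $ i" if "v \<in> carrier_vec n" "i < n" for v i
  proof -
    have "(D *\<^sub>v v) $ i = (\<Sum>j<n. D $$ (i, j) * v $ j)"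
      using that D by (auto simp: scalar_prod_def lessThan_atLeast0)
    also have "\<dots> = (\<Sum>j<n. if j = i then D $$ (i, i) * v $ i else 0)"
      using that D diag by (intro sum.cong) (auto simp: diagonal_mat_def)
    finally show ?thesis using that by simp
  qed
  have ker: "v \<in> mat_kernel D \<longleftrightarrow> v \<in> carrier_vec n \<and> (\<forall>i<n. i \<notin> Z \<longrightarrow> v $ i = 0)" for v
  proof -
    have "D *\<^sub>v v = 0\<^sub>v n \<longleftrightarrow> (\<forall>i<n. D $$ (i, i) * v $ i = 0)" if v: "v \<in> carrier_vec n"
      using Dv[OF v] D by (auto simp: vec_eq_iff)
    thus ?thesis using D by (auto simp: mat_kernel[OF D] Z_def)
  qed
  have fin: "finite S" by (simp add: S_def Z_def)
  have sub: "S \<subseteq> mat_kernel D" by (auto simp: ker S_def Z_def)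
  have "S \<subseteq> set (unit_vecs n)" by (auto simp: S_def Z_def unit_vecs_def)
  hence "\<not> NC.lin_dep S"
    using NC.unit_vecs_basis NC.subset_li_is_li unfolding NC.basis_def by blast
  hence indep: "lin_indpt S" using lindep_same[OF sub] by simp
  have inj: "inj_on (unit_vec n :: nat \<Rightarrow> complex vec) Z"
    by (rule inj_onI) (metis (mono_tags) Z_def index_unit_vec(1) mem_Collect_eq one_neq_zero)
  have "v \<in> span S" if v: "v \<in> mat_kernel D" for v
  proof -
    have vn: "v \<in> carrier_vec n" using v ker by simp
    have lc: "lincomb (\<lambda>u. u \<bullet> v) S \<in> mat_kernel D"
      using sub by (intro Ker.lincomb_closed) auto
    \<comment> \<open>Pairing with a unit vector reads off a coordinate of \<open>v\<close>.\<close>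
    have "v = lincomb (\<lambda>u. u \<bullet> v) S"
    proof (rule eq_vecI)
      fix i assume "i < dim_vec (lincomb (\<lambda>u. u \<bullet> v) S)"
      hence i: "i < n" using lc ker by auto
      have "lincomb (\<lambda>u. u \<bullet> v) S $ i = (\<Sum>j\<in>Z. (unit_vec n j \<bullet> v) * unit_vec n j $ i)"
        using lincomb_index[OF i sub] by (simp add: S_def sum.reindex[OF inj])
      also have "\<dots> = (\<Sum>j\<in>Z. if j = i then v $ i else 0)"
        using i vn by (intro sum.cong) (auto simp: Z_def)
      also have "\<dots> = v $ i" using v i by (auto simp: ker Z_def)
      finally show "v $ i = lincomb (\<lambda>u. u \<bullet> v) S $ i" by simp
    qed (use lc vn ker in auto)
    thus ?thesis using fin sub unfolding Ker.span_def by blast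
  qed
  hence "span S = mat_kernel D" using Ker.span_is_subset2[OF sub] by auto
  hence "basis S" using indep sub by (simp add: Ker.basis_def)
  hence "dim = card S" by (rule Ker.dim_basis[OF fin])
  thus ?thesis using inj by (simp add: S_def card_image Z_def)
qed


text \<open>
  If \<open>D = W\<^sup>* M W\<close> is diagonal and \<open>P\<close> is the inverse of \<open>W\<^sup>*\<close>, then \<open>M = P D P\<^sup>*\<close>; the diagonal of \<open>D\<close>
  is real because \<open>D\<close> is again Hermitian. The matrix \<open>R = W\<^sup>*\<close> later recovers the old forms from
  the new ones. The kernel of \<open>M\<close> has the dimension of that of \<open>D\<close>, since multiplying by invertible
  matrices on either side does not change it.
\<close>

lemma hermitian_mat_signed_decomposition:
  fixes M :: "complex mat"
  assumes M: "M \<in> carrier_mat m m" and herm: "hermitian_mat M"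
  shows "\<exists>P R (d :: nat \<Rightarrow> real).
    P \<in> carrier_mat m m \<and> R \<in> carrier_mat m m \<and> P * R = 1\<^sub>m m \<and>
    (\<forall>j<m. \<forall>k<m.
      M $$ (j, k) = (\<Sum>l<m. of_real (d l) * (P $$ (j, l) * cnj (P $$ (k, l))))) \<and>
    kernel_dim M = card {l. l < m \<and> d l = 0}"
proof -
  obtain W where W: "W \<in> carrier_mat m m" "det W \<noteq> 0"
    and diag: "diagonal_mat (mat_adjoint W * M * W)"
    using hermitian_mat_diagonalizable_congruence[OF M herm] by blast
  define R where "R = mat_adjoint W"
  define D where "D = R * M * W"
  have R: "R \<in> carrier_mat m m" "det R \<noteq> 0"
    using W det_mat_adjoint_nonzero by (auto simp: R_def)
  have D: "D \<in> carrier_mat m m"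
    unfolding D_def by (rule mult_carrier_mat[OF mult_carrier_mat[OF R(1) M] W(1)])
  obtain P where P: "P \<in> carrier_mat m m" "P * R = 1\<^sub>m m" "R * P = 1\<^sub>m m"
    using inverse_mat_obtain[OF R] by metis
  have P': "mat_adjoint P \<in> carrier_mat m m" using P by simp
  have "mat_adjoint (1\<^sub>m m :: complex mat) = 1\<^sub>m m"
    by (rule eq_matI) (auto simp: mat_adjoint_index)
  hence WP: "W * mat_adjoint P = 1\<^sub>m m" "mat_adjoint P * W = 1\<^sub>m m"
    using mat_adjoint_mult[OF P(1) R(1)] mat_adjoint_mult[OF R(1) P(1)] P by (simp_all add: R_def)
  have "P * D * mat_adjoint P = (P * R) * M * (W * mat_adjoint P)"
    unfolding D_def by (rule mult_mat_regroup[OF P(1) R(1) M W(1) P'])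
  hence PDP: "M = P * D * mat_adjoint P" using P WP M by simp
  have PD: "P * D \<in> carrier_mat m m" by (rule mult_carrier_mat[OF P(1) D])
  have real: "D $$ (l, l) = of_real (Re (D $$ (l, l)))" if "l < m" for l
  proof -
    have "hermitian_mat D" unfolding D_def R_def by (rule hermitian_mat_congruent[OF herm M W(1)])
    from hermitian_mat_index[OF this D that that] show ?thesis
      by (simp add: complex_eq_iff)
  qed
  have dD: "diagonal_mat D" using diag by (simp add: D_def R_def)
  have "kernel_dim M = kernel.dim m M" using M by (simp add: kernel_dim_def)
  also have "\<dots> = kernel.dim m (P * D * mat_adjoint P)" using PDP by simp
  also have "\<dots> = kernel.dim m (P * D)"
    by (rule mat_kernel_dim_mult_eq_right[OF PD P' W(1) WP(2)])
  also have "\<dots> = kernel.dim m D" by (simp only: mat_kernel_mult_eq[OF D P(1) R(1) P(3)])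
  also have "\<dots> = card {i. i < m \<and> D $$ (i, i) = 0}"
    using kernel_dim_diagonal_mat[OF D dD] D by (simp add: kernel_dim_def)
  also have "\<dots> = card {i. i < m \<and> Re (D $$ (i, i)) = 0}"
    using real by (metis (no_types, lifting) of_real_0 zero_complex.sel(1))
  finally have "kernel_dim M = card {l. l < m \<and> Re (D $$ (l, l)) = 0}" .
  moreover have "M $$ (j, k) = (\<Sum>l<m. of_real (Re (D $$ (l, l))) * (P $$ (j, l) * cnj (P $$ (k, l))))"
    if j: "j < m" and k: "k < m" for j k
  proof -
    have PDl: "(P * D) $$ (j, l) = P $$ (j, l) * D $$ (l, l)" if "l < m" for l
    proof -
      have "(P * D) $$ (j, l) = (\<Sum>i<m. P $$ (j, i) * D $$ (i, l))"
        using P D j that by (auto simp: scalar_prod_def lessThan_atLeast0)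
      also have "\<dots> = (\<Sum>i<m. if i = l then P $$ (j, l) * D $$ (l, l) else 0)"
        using dD D that by (intro sum.cong) (auto simp: diagonal_mat_def)
      finally show ?thesis using that by simp
    qed
    have "M $$ (j, k) = (\<Sum>l<m. (P * D) $$ (j, l) * mat_adjoint P $$ (l, k))"
      unfolding PDP using PD P' j k
      by (subst index_mult_mat(1))
        (use P(1) in \<open>auto simp: scalar_prod_def lessThan_atLeast0 simp del: index_mult_mat(1)\<close>)
    also have "\<dots> = (\<Sum>l<m. of_real (Re (D $$ (l, l))) * (P $$ (j, l) * cnj (P $$ (k, l))))"
    proof (rule sum.cong)
      fix l assume "l \<in> {..<m}"
      thus "(P * D) $$ (j, l) * mat_adjoint P $$ (l, k) =
        of_real (Re (D $$ (l, l))) * (P $$ (j, l) * cnj (P $$ (k, l)))"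
        using PDl[of l] real[of l] P k by (simp add: mat_adjoint_index)
    qed simp
    finally show ?thesis .
  qed
  ultimately show ?thesis
    using P R by (intro exI[of _ P] exI[of _ R] exI[of _ "\<lambda>l. Re (D $$ (l, l))"]) simp
qed

section \<open>Differentials and wedge products under a change of forms\<close>

lemma sum_fun_apply: "(\<Sum>i\<in>I. f i) x = (\<Sum>i\<in>I. f i x)"
  by (induction I rule: infinite_finite_induct) auto

lemma ce_d_scale: "ce_d br (scale1 c \<alpha>) = scale2 c (ce_d br \<alpha>)"
  by (auto simp: ce_d_def scale1_def scale2_def)

lemma ce_d_sum: "ce_d br (\<Sum>i\<in>I. f i) = (\<Sum>i\<in>I. ce_d br (f i))"
  by (intro ext) (simp add: ce_d_def sum_fun_apply sum_negf)

lemma wedge_cnj_scale: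
  fixes c :: real
  shows "wedge (scale1 (of_real c) \<alpha>) (cnj_form (scale1 (of_real c) \<alpha>)) =
    scale2 (of_real (c ^ 2)) (wedge \<alpha> (cnj_form \<alpha>))"
  by (intro ext) (simp add: wedge_def cnj_form_def scale1_def scale2_def power2_eq_square algebra_simps)

text \<open>
  The 2-form attached to \<open>M\<close> is the antisymmetrisation of the sesquilinear form \<open>S\<close> with matrix \<open>M\<close>
  in the forms \<open>\<omega>\<close>. It therefore suffices to expand \<open>S\<close>, in which the factorisation of \<open>M\<close>
  separates into a product of two linear combinations for each diagonal entry.
\<close>

lemma wedge_cnj_congruence:
  fixes M P :: "complex mat" and d :: "nat \<Rightarrow> real" and \<omega> :: "nat \<Rightarrow> 'a \<Rightarrow> complex"
  assumes M: "\<And>j k. j < m \<Longrightarrow> k < m \<Longrightarrow>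
    M $$ (j, k) = (\<Sum>l<m. of_real (d l) * (P $$ (j, l) * cnj (P $$ (k, l))))"
  defines "\<tau> \<equiv> \<lambda>l. \<Sum>j<m. scale1 (P $$ (j, l)) (\<omega> j)"
  shows "(\<Sum>j<m. \<Sum>k<m. scale2 (M $$ (j, k)) (wedge (\<omega> j) (cnj_form (\<omega> k)))) =
    (\<Sum>l<m. scale2 (of_real (d l)) (wedge (\<tau> l) (cnj_form (\<tau> l))))"
proof -
  define S where "S x y = (\<Sum>j<m. \<Sum>k<m. M $$ (j, k) * (\<omega> j x * cnj (\<omega> k y)))" for x y
  have S: "S x y = (\<Sum>l<m. of_real (d l) * (\<tau> l x * cnj (\<tau> l y)))" for x y
  proof -
    have "S x y = (\<Sum>j<m. \<Sum>k<m. \<Sum>l<m. of_real (d l) *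
        ((P $$ (j, l) * \<omega> j x) * cnj (P $$ (k, l) * \<omega> k y)))"
      unfolding S_def
      by (intro sum.cong refl) (simp add: M sum_distrib_left sum_distrib_right mult_ac)
    also have "\<dots> = (\<Sum>l<m. \<Sum>j<m. \<Sum>k<m. of_real (d l) *
        ((P $$ (j, l) * \<omega> j x) * cnj (P $$ (k, l) * \<omega> k y)))"
      by (subst sum.swap[of _ "{..<m}" "{..<m}"], subst (2) sum.swap) (rule refl)
    also have "\<dots> = (\<Sum>l<m. of_real (d l) * (\<tau> l x * cnj (\<tau> l y)))"
      unfolding \<tau>_def sum_fun_apply scale1_def cnj_sum sum_product
      unfolding sum_distrib_left by (rule refl)
    finally show ?thesis .
  qed
  show ?thesis
  proof (intro ext)
    fix x y
    have "(\<Sum>j<m. \<Sum>k<m. scale2 (M $$ (j, k)) (wedge (\<omega> j) (cnj_form (\<omega> k)))) x y = S x y - S y x"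
      by (simp add: S_def sum_fun_apply scale2_def wedge_def cnj_form_def right_diff_distrib sum_subtractf)
    also have "\<dots> = (\<Sum>l<m. scale2 (of_real (d l)) (wedge (\<tau> l) (cnj_form (\<tau> l)))) x y"
      unfolding S
      by (simp add: sum_fun_apply scale2_def wedge_def cnj_form_def right_diff_distrib sum_subtractf)
    finally show "(\<Sum>j<m. \<Sum>k<m. scale2 (M $$ (j, k)) (wedge (\<omega> j) (cnj_form (\<omega> k)))) x y =
      (\<Sum>l<m. scale2 (of_real (d l)) (wedge (\<tau> l) (cnj_form (\<tau> l)))) x y" .
  qed
qed

section \<open>Bases and the ordering of signs\<close>

text \<open>
  The image of \<open>g\<close> contains a basis of the common span. That basis has \<open>card I\<close> elements, which leaves
  no room in the image of \<open>g\<close> for repetitions or for further elements.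
\<close>

lemma (in vector_space) same_span_imp_basis_family:
  assumes fin: "finite I" and inj: "inj_on f I" and indep: "independent (f ` I)"
    and sp: "span (g ` I) = span (f ` I)"
  shows "inj_on g I" "independent (g ` I)"
proof -
  have "dim (g ` I) = card I"
    using span_eq_dim[OF sp] dim_eq_card_independent[OF indep] card_image[OF inj] by simp
  moreover obtain B where B: "B \<subseteq> g ` I" "independent B" "card B = dim (g ` I)"
    by (rule basis_exists)
  ultimately have *: "card (g ` I) \<le> card B" using card_image_le[OF fin] by simp
  hence "B = g ` I" using B fin by (intro card_seteq) auto
  thus "independent (g ` I)" "inj_on g I"
    using B \<open>dim (g ` I) = card I\<close> fin by (auto intro: eq_card_imp_inj_on)
qed

text \<open>
  The positions of the positive, negative and zero values partition \<open>{..<m}\<close>, and three consecutive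
  intervals of the same sizes partition \<open>{1..m}\<close>; a bijection is chosen on each part.
\<close>

lemma sign_sorting_bij:
  fixes d :: "nat \<Rightarrow> real" and m :: nat
  defines "p \<equiv> card {l. l < m \<and> d l > 0}" and "q \<equiv> card {l. l < m \<and> d l < 0}"
  shows "p + q + card {l. l < m \<and> d l = 0} = m"
    and "\<exists>\<pi>. bij_betw \<pi> {1..m} {..<m} \<and> (\<forall>j\<in>{1..p}. d (\<pi> j) > 0) \<and>
      (\<forall>j\<in>{p+1..p+q}. d (\<pi> j) < 0) \<and> (\<forall>j\<in>{p+q+1..m}. d (\<pi> j) = 0)"
proof -
  define A where "A = {l. l < m \<and> d l > 0}"
  define B where "B = {l. l < m \<and> d l < 0}"
  define C where "C = {l. l < m \<and> d l = 0}"
  have fin: "finite A" "finite B" "finite C" by (auto simp: A_def B_def C_def)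
  have un: "{..<m} = A \<union> B \<union> C" and dis: "A \<inter> B = {}" "(A \<union> B) \<inter> C = {}"
    by (auto simp: A_def B_def C_def)
  have total: "p + q + card C = m"
    using card_Un_disjoint[OF fin(1,2) dis(1)] card_Un_disjoint[of "A \<union> B" C] fin dis un
      card_lessThan[of m]
    by (simp add: p_def q_def A_def B_def)
  obtain f where f: "bij_betw f {1..p} A"
    using finite_same_card_bij[of "{1..p}" A] fin by (auto simp: p_def A_def)
  obtain g where g: "bij_betw g {p+1..p+q} B"
    using finite_same_card_bij[of "{p+1..p+q}" B] fin by (auto simp: q_def B_def)
  obtain h where h: "bij_betw h {p+q+1..m} C"
    using finite_same_card_bij[of "{p+q+1..m}" C] fin total by auto
  define \<pi> where "\<pi> j = (if j \<le> p then f j else if j \<le> p + q then g j else h j)" for j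
  have 1: "bij_betw \<pi> {1..p} A"
    using f by (subst bij_betw_cong[of _ _ f]) (auto simp: \<pi>_def)
  have 2: "bij_betw \<pi> {p+1..p+q} B"
    using g by (subst bij_betw_cong[of _ _ g]) (auto simp: \<pi>_def)
  have 3: "bij_betw \<pi> {p+q+1..m} C"
    using h by (subst bij_betw_cong[of _ _ h]) (auto simp: \<pi>_def)
  have "bij_betw \<pi> ({1..p} \<union> {p+1..p+q} \<union> {p+q+1..m}) {..<m}"
    unfolding un by (intro bij_betw_combine 1 2 3 dis)
  moreover have "{1..p} \<union> {p+1..p+q} \<union> {p+q+1..m} = {1..m}" using total by auto
  ultimately have "bij_betw \<pi> {1..m} {..<m}" by simp
  moreover have "d (\<pi> j) > 0" if "j \<in> {1..p}" for j
    using bij_betwE[OF 1] that by (auto simp: A_def)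
  moreover have "d (\<pi> j) < 0" if "j \<in> {p+1..p+q}" for j
    using bij_betwE[OF 2] that by (auto simp: B_def)
  moreover have "d (\<pi> j) = 0" if "j \<in> {p+q+1..m}" for j
    using bij_betwE[OF 3] that by (auto simp: C_def)
  ultimately show "\<exists>\<pi>. bij_betw \<pi> {1..m} {..<m} \<and> (\<forall>j\<in>{1..p}. d (\<pi> j) > 0) \<and>
      (\<forall>j\<in>{p+1..p+q}. d (\<pi> j) < 0) \<and> (\<forall>j\<in>{p+q+1..m}. d (\<pi> j) = 0)"
    by blast
  show "p + q + card {l. l < m \<and> d l = 0} = m" using total by (simp add: C_def)
qed

section \<open>The normal form of the structure equations\<close>

theorem theorem2p13:
  fixes n r :: nat
    and br :: "'a::real_vector \<Rightarrow> 'a \<Rightarrow> 'a"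
    and J :: "'a \<Rightarrow> 'a"
    and \<omega> :: "nat \<Rightarrow> 'a \<Rightarrow> complex"
    and M :: "complex mat"
  assumes n: "n \<ge> 2"
    and lie: "real_lie_algebra br"
    and dim: "real_vector.dim (UNIV :: 'a set) = 2 * n"
    and nilpotent: "nilpotent_bracket br"
    and J: "one_abelian n br J"
    and \<omega>: "basis10 n J \<omega>"
    and closed: "\<forall>i\<in>{1..n-1}. ce_d br (\<omega> i) = 0"
    and M: "M \<in> carrier_mat (n - 1) (n - 1)"
    and hermitian: "hermitian_mat M"
    and structure_eq: "ce_d br (\<omega> n) =
      (\<Sum>j=1..n-1. \<Sum>k=1..n-1. scale2 (M $$ (j - 1, k - 1)) (wedge (\<omega> j) (cnj_form (\<omega> k))))"
    and r: "r = kernel_dim M"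
  shows "\<exists>\<sigma> k.
    basis10 n J \<sigma> \<and>
    (if odd (n - r) then k \<in> {(n - 1 - r) div 2 .. n - 1 - r}
     else k \<in> {(n - 1 - r) div 2 + 1 .. n - 1 - r}) \<and>
    (\<forall>i\<in>{1..n-1}. ce_d br (\<sigma> i) = 0) \<and>
    ce_d br (\<sigma> n) = (\<Sum>j=1..k. wedge (\<sigma> j) (cnj_form (\<sigma> j)))
      - (\<Sum>j=k+1..n-1-r. wedge (\<sigma> j) (cnj_form (\<sigma> j)))"
proof -
  define m where "m = n - 1"
  have nm: "n = Suc m" using n by (simp add: m_def)
  obtain P R :: "complex mat" and d :: "nat \<Rightarrow> real"
    where P: "P \<in> carrier_mat m m" and R: "R \<in> carrier_mat m m" and PR: "P * R = 1\<^sub>m m"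
    and MP: "\<forall>j<m. \<forall>k<m.
      M $$ (j, k) = (\<Sum>l<m. of_real (d l) * (P $$ (j, l) * cnj (P $$ (k, l))))"
    and ker: "kernel_dim M = card {l. l < m \<and> d l = 0}"
    using hermitian_mat_signed_decomposition[OF M[folded m_def] hermitian] by (elim exE conjE)
  define \<tau> where "\<tau> l = (\<Sum>j<m. scale1 (P $$ (j, l)) (\<omega> (Suc j)))" for l
  have d\<omega>: "ce_d br (\<omega> n) = (\<Sum>l<m. scale2 (of_real (d l)) (wedge (\<tau> l) (cnj_form (\<tau> l))))"
  proof -
    have "ce_d br (\<omega> n) =
        (\<Sum>j<m. \<Sum>k<m. scale2 (M $$ (j, k)) (wedge (\<omega> (Suc j)) (cnj_form (\<omega> (Suc k)))))"
      by (simp add: structure_eq sum.atLeast1_atMost_eq m_def)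
    also have "\<dots> = (\<Sum>l<m. scale2 (of_real (d l)) (wedge (\<tau> l) (cnj_form (\<tau> l))))"
      unfolding \<tau>_def by (rule wedge_cnj_congruence) (use MP in blast)
    finally show ?thesis .
  qed
  have d\<tau>: "ce_d br (\<tau> l) = 0" for l
    using closed by (simp add: \<tau>_def ce_d_sum ce_d_scale nm)
  have \<omega>_\<tau>: "\<omega> (Suc k) = (\<Sum>l<m. scale1 (R $$ (l, k)) (\<tau> l))" if k: "k < m" for k
  proof
    fix x
    have "(\<Sum>l<m. scale1 (R $$ (l, k)) (\<tau> l)) x =
        (\<Sum>l<m. \<Sum>j<m. P $$ (j, l) * R $$ (l, k) * \<omega> (Suc j) x)"
      by (simp add: \<tau>_def sum_fun_apply scale1_def sum_distrib_left mult_ac)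
    also have "\<dots> = (\<Sum>j<m. (P * R) $$ (j, k) * \<omega> (Suc j) x)"
      using P R k
      by (subst sum.swap) (simp add: scalar_prod_def lessThan_atLeast0 sum_distrib_right)
    also have "\<dots> = (\<Sum>j<m. if j = k then \<omega> (Suc k) x else 0)"
      unfolding PR using k by (intro sum.cong) auto
    finally show "\<omega> (Suc k) x = (\<Sum>l<m. scale1 (R $$ (l, k)) (\<tau> l)) x" using k by simp
  qed
  \<comment> \<open>The sign of the last form: with it, positive entries are at least as many as negative ones.\<close>
  define s :: real where
    "s = (if card {l. l < m \<and> d l < 0} \<le> card {l. l < m \<and> d l > 0} then 1 else -1)"
  have s: "s = 1 \<or> s = -1" by (simp add: s_def)
  define p where "p = card {l. l < m \<and> s * d l > 0}"
  define q where "q = card {l. l < m \<and> s * d l < 0}"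
  have qp: "q \<le> p" by (auto simp: p_def q_def s_def)
  have sorting: "\<exists>\<pi>. bij_betw \<pi> {1..m} {..<m} \<and> (\<forall>j\<in>{1..p}. s * d (\<pi> j) > 0) \<and>
      (\<forall>j\<in>{p+1..p+q}. s * d (\<pi> j) < 0) \<and> (\<forall>j\<in>{p+q+1..m}. s * d (\<pi> j) = 0)"
    and "p + q + card {l. l < m \<and> s * d l = 0} = m"
    unfolding p_def q_def by (rule sign_sorting_bij)+
  hence pqr: "p + q + r = m" using s by (auto simp: r ker)
  have range: "n - 1 - r = p + q" using pqr by (simp add: nm)
  from sorting obtain \<pi> where \<pi>: "bij_betw \<pi> {1..m} {..<m}"
    and pos: "\<forall>j\<in>{1..p}. s * d (\<pi> j) > 0"
    and neg: "\<forall>j\<in>{p+1..p+q}. s * d (\<pi> j) < 0"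
    and zero: "\<forall>j\<in>{p+q+1..m}. s * d (\<pi> j) = 0"
    by (elim exE conjE)
  \<comment> \<open>The kernel directions are not rescaled, so that every factor is invertible.\<close>
  define c where "c j = (if d (\<pi> j) = 0 then 1 else sqrt \<bar>d (\<pi> j)\<bar>)" for j
  have c0: "c j \<noteq> 0" for j by (simp add: c_def)
  define \<sigma> where "\<sigma> j = (if j = n then scale1 (of_real s) (\<omega> n)
    else scale1 (of_real (c j)) (\<tau> (\<pi> j)))" for j
  have \<sigma>: "\<sigma> j = scale1 (of_real (c j)) (\<tau> (\<pi> j))" if "j \<in> {1..m}" for j
    using that by (simp add: \<sigma>_def nm)
  let ?w = "\<lambda>j. wedge (\<sigma> j) (cnj_form (\<sigma> j))"
  have "ce_d br (\<sigma> n) =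
      (\<Sum>l<m. scale2 (of_real (s * d l)) (wedge (\<tau> l) (cnj_form (\<tau> l))))"
    by (simp add: \<sigma>_def ce_d_scale d\<omega> form2.scale_sum_right)
  also have "\<dots> = (\<Sum>j=1..m. scale2 (of_real (s * d (\<pi> j))) (wedge (\<tau> (\<pi> j)) (cnj_form (\<tau> (\<pi> j)))))"
    by (rule sum.reindex_bij_betw[OF \<pi>, symmetric])
  also have "\<dots> = (\<Sum>j=1..m. scale2 (of_real (sgn (s * d (\<pi> j)))) (?w j))"
  proof (rule sum.cong)
    fix j assume j: "j \<in> {1..m}"
    have "s * d (\<pi> j) = sgn (s * d (\<pi> j)) * c j ^ 2"
      using s by (auto simp: c_def sgn_if)
    thus "scale2 (of_real (s * d (\<pi> j))) (wedge (\<tau> (\<pi> j)) (cnj_form (\<tau> (\<pi> j)))) =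
        scale2 (of_real (sgn (s * d (\<pi> j)))) (?w j)"
      by (metis \<sigma>[OF j] form2.scale_scale of_real_mult wedge_cnj_scale)
  qed simp
  also have "{1..m} = {1..p} \<union> ({p+1..p+q} \<union> {p+q+1..m})" using pqr by auto
  also have "(\<Sum>j\<in>\<dots>. scale2 (of_real (sgn (s * d (\<pi> j)))) (?w j)) =
      (\<Sum>j=1..p. scale2 (of_real (sgn (s * d (\<pi> j)))) (?w j)) +
      ((\<Sum>j=p+1..p+q. scale2 (of_real (sgn (s * d (\<pi> j)))) (?w j)) +
       (\<Sum>j=p+q+1..m. scale2 (of_real (sgn (s * d (\<pi> j)))) (?w j)))"
    by (subst sum.union_disjoint; (subst sum.union_disjoint)?) auto
  also have "(\<Sum>j=1..p. scale2 (of_real (sgn (s * d (\<pi> j)))) (?w j)) = (\<Sum>j=1..p. ?w j)"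
    using pos by (intro sum.cong) auto
  also have "(\<Sum>j=p+1..p+q. scale2 (of_real (sgn (s * d (\<pi> j)))) (?w j)) = - (\<Sum>j=p+1..p+q. ?w j)"
    unfolding sum_negf[symmetric] using neg by (intro sum.cong) auto
  also have "(\<Sum>j=p+q+1..m. scale2 (of_real (sgn (s * d (\<pi> j)))) (?w j)) = 0"
    using zero by (intro sum.neutral) auto
  finally have d\<sigma>: "ce_d br (\<sigma> n) = (\<Sum>j=1..p. ?w j) - (\<Sum>j=p+1..n-1-r. ?w j)"
    unfolding range by (simp only: add_0_right diff_conv_add_uminus)
  have closed\<sigma>: "\<forall>i\<in>{1..n-1}. ce_d br (\<sigma> i) = 0"
    by (auto simp: \<sigma>_def ce_d_scale d\<tau> nm)
  have span_eq: "form1.span (\<sigma> ` {1..n}) = form1.span (\<omega> ` {1..n})"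
  proof (subst form1.span_eq, intro conjI subsetI)
    fix \<alpha> assume "\<alpha> \<in> \<sigma> ` {1..n}"
    then obtain j where j: "j \<in> {1..n}" "\<alpha> = \<sigma> j" by auto
    have "\<tau> l \<in> form1.span (\<omega> ` {1..n})" for l
      unfolding \<tau>_def by (intro form1.span_sum form1.span_scale form1.span_base) (auto simp: nm)
    moreover have "\<omega> n \<in> form1.span (\<omega> ` {1..n})"
      by (intro form1.span_base) (auto simp: nm)
    ultimately show "\<alpha> \<in> form1.span (\<omega> ` {1..n})"
      using j by (auto simp: \<sigma>_def intro!: form1.span_scale)
  next
    fix \<alpha> assume "\<alpha> \<in> \<omega> ` {1..n}"
    then obtain j where j: "j \<in> {1..n}" "\<alpha> = \<omega> j" by auto
    have \<tau>_span: "\<tau> l \<in> form1.span (\<sigma> ` {1..n})" if l: "l < m" for l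
    proof -
      have "l \<in> \<pi> ` {1..m}" using l \<pi> by (simp add: bij_betw_def)
      then obtain i where i: "i \<in> {1..m}" "l = \<pi> i" by blast
      have "\<tau> l = scale1 (of_real (1 / c i)) (\<sigma> i)"
        using c0[of i] by (simp add: \<sigma>[OF i(1)] i(2))
      moreover have "\<sigma> i \<in> form1.span (\<sigma> ` {1..n})"
        by (intro form1.span_base imageI) (use i in \<open>simp add: nm\<close>)
      ultimately show ?thesis by (simp only: form1.span_scale)
    qed
    show "\<alpha> \<in> form1.span (\<sigma> ` {1..n})"
    proof (cases "j = n")
      case True
      have "\<omega> n = scale1 (of_real s) (\<sigma> n)" using s by (auto simp: \<sigma>_def)
      moreover have "\<sigma> n \<in> form1.span (\<sigma> ` {1..n})"
        by (intro form1.span_base imageI) (simp add: nm)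
      ultimately show ?thesis using True j(2) by (simp only: form1.span_scale)
    next
      case False
      then obtain k where "j = Suc k" "k < m" using j by (cases j) (auto simp: nm)
      hence "\<alpha> = (\<Sum>l<m. scale1 (R $$ (l, k)) (\<tau> l))" using j(2) \<omega>_\<tau> by simp
      thus ?thesis using \<tau>_span by (auto intro!: form1.span_sum form1.span_scale)
    qed
  qed
  hence "basis10 n J \<sigma>"
    using \<omega> form1.same_span_imp_basis_family[of "{1..n}" \<omega> \<sigma>] unfolding basis10_def by blast
  moreover have "if odd (n - r) then p \<in> {(n - 1 - r) div 2 .. n - 1 - r}
     else p \<in> {(n - 1 - r) div 2 + 1 .. n - 1 - r}"
  proof -
    have nr: "n - r = Suc (p + q)" using pqr by (simp add: nm)
    show ?thesis
    proof (cases "odd (n - r)")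
      case True
      have "(p + q) div 2 \<le> p" using qp by linarith
      thus ?thesis using True unfolding range by simp
    next
      case False
      hence "q \<noteq> p" using nr by auto
      hence "(p + q) div 2 + 1 \<le> p" using qp by linarith
      thus ?thesis using False unfolding range by simp
    qed
  qed
  ultimately show ?thesis using closed\<sigma> d\<sigma> by blast
qed
end
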